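(* Let $q$ be a prime power and let $f(X)=X^2+bX+c\in\mathbb F_q[X]$ be irreducible. Then $f(X)$ divides $X^{q+1}-c$, and one writes $$H_f(X)=\frac{X^{q+2}-cX}{f(X)}=h_1X^q+h_2X^{q-1}+\cdots+h_qX+h_{q+1},$$ where $h_{q+1}=0$. Let $$r=\min\{2\le i\le q+1:\ h_i=0\}$$ and $\lambda=-c\,h_{r-1}$. Then the binomial order of $f(X)$ is $r$ and the minimal binomial multiple of $f(X)$ is $X^r-\lambda$. Consequently, the order of $f(X)$ is $r\cdot\operatorname{ord}(\lambda)$.
   Context: For $\lambda\in\mathbb F_q^*$, $\operatorname{ord}(\lambda)$ is its multiplicative order. For a nonconstant monic polynomial $f\in\mathbb F_q[X]$ with nonzero constant term, the order of $f$ is the smallest positive integer $n$ such that $f(X)\mid X^n-1$. The minimal binomial multiple of $f$ is the monic binomial $X^r-\lambda\in\mathbb F_q[X]$ (with $\lambda\neq0$) of lowest degree among the binomials over $\mathbb F_q$ divisible by $f$; its degree $r$ is the binomial order of $f$. *)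

theory Defs
  imports "HOL-Computational_Algebra.Computational_Algebra" "HOL-Library.Cardinality"
begin

definition mult_order :: "'a::monoid_mult \<Rightarrow> nat" where
  "mult_order x = (LEAST n. 0 < n \<and> x ^ n = 1)"

(* The name order is already taken in the library by the multiplicity of a root. *)
definition polynomial_order :: "'a::field poly \<Rightarrow> nat" where
  "polynomial_order f = (LEAST n. 0 < n \<and> f dvd monom 1 n - 1)"

(* Positive degree is required explicitly: for r = 0 and l = 1 the expression below would be
   the zero polynomial, which every f divides. *)
definition is_monic_binomial :: "'a::field poly \<Rightarrow> bool" where
  "is_monic_binomial g \<longleftrightarrow> (\<exists>r l. 0 < r \<and> l \<noteq> 0 \<and> g = monom 1 r - [:l:])"

definition is_minimal_binomial_multiple :: "'a::field poly \<Rightarrow> 'a poly \<Rightarrow> bool" where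
  "is_minimal_binomial_multiple f g \<longleftrightarrow>
     is_arg_min degree (\<lambda>g. is_monic_binomial g \<and> f dvd g) g"

definition minimal_binomial_multiple :: "'a::field poly \<Rightarrow> 'a poly" where
  "minimal_binomial_multiple f = (THE g. is_minimal_binomial_multiple f g)"

definition binomial_order :: "'a::field poly \<Rightarrow> nat" where
  "binomial_order f = degree (minimal_binomial_multiple f)"

text \<open>
  Over a finite field the description operators above select genuine values: the least
  exponents exist, and the minimal binomial multiple exists and is unique.
\<close>

lemma mult_order_exists:
  fixes x :: "'a::{finite,field}"
  assumes "x \<noteq> 0"
  shows "\<exists>n>0. x ^ n = 1"
proof -
  have "\<not> inj (\<lambda>n::nat. x ^ n)"
    using finite_imageD[of "\<lambda>n::nat. x ^ n" UNIV] by auto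
  then obtain i j :: nat where "x ^ i = x ^ j" "i \<noteq> j"
    unfolding inj_def by blast
  then obtain i j :: nat where ij: "x ^ i = x ^ j" "i < j"
    by (metis linorder_neqE_nat)
  from ij(2) obtain d where d: "j = i + d" "0 < d"
    using less_imp_add_positive by metis
  have "x ^ i * x ^ d = x ^ i * 1"
    using ij(1) unfolding d(1) power_add by simp
  then have "x ^ d = 1"
    using assms by simp
  then show ?thesis using d(2) by blast
qed

lemma polynomial_order_exists:
  fixes f :: "'a::{finite,field} poly"
  assumes "0 < degree f" "coeff f 0 \<noteq> 0"
  shows "\<exists>n>0. f dvd monom 1 n - 1"
proof -
  define X :: "'a poly" where "X = [:0, 1:]"
  let ?L = "{xs :: 'a list. set xs \<subseteq> UNIV \<and> length xs \<le> degree f}"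
  have "range (\<lambda>n::nat. X ^ n mod f) \<subseteq> Poly ` ?L"
  proof safe
    fix n :: nat
    let ?p = "X ^ n mod f"
    have "f \<noteq> 0" using assms(1) by auto
    then have "?p = 0 \<or> degree ?p < degree f" by (rule degree_mod_less)
    then have "length (coeffs ?p) \<le> degree f"
      by (cases "?p = 0") (auto simp: length_coeffs_degree)
    then show "?p \<in> Poly ` ?L"
      by (intro image_eqI[of _ _ "coeffs ?p"]) auto
  qed
  moreover have "finite (Poly ` ?L)"
    by (intro finite_imageI finite_lists_length_le finite)
  ultimately have "finite (range (\<lambda>n::nat. X ^ n mod f))"
    by (rule finite_subset)
  then have "\<not> inj (\<lambda>n::nat. X ^ n mod f)"
    using finite_imageD[of "\<lambda>n::nat. X ^ n mod f" UNIV] by auto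
  then obtain i j :: nat where "X ^ i mod f = X ^ j mod f" "i \<noteq> j"
    unfolding inj_def by blast
  then obtain i j :: nat where ij: "X ^ j mod f = X ^ i mod f" "i < j"
    by (metis linorder_neqE_nat)
  from ij(2) obtain d where d: "j = i + d" "0 < d"
    using less_imp_add_positive by metis
  have "f dvd X ^ j - X ^ i" using ij(1) by (simp only: mod_eq_dvd_iff)
  also have "X ^ j - X ^ i = X ^ i * (X ^ d - 1)"
    unfolding d(1) power_add by (simp only: right_diff_distrib mult_1_right)
  finally have dvd: "f dvd X ^ i * (X ^ d - 1)" .
  obtain a p where f: "f = pCons a p" by (cases f)
  have cancel: "f dvd u" if "f dvd X * u" for u
  proof -
    have "f * u - p * (X * u) = smult a u"
      by (simp add: f X_def)
    then have "f dvd smult a u"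
      using that by (metis dvd_diff dvd_mult dvd_triv_left)
    then show "f dvd u" using assms(2) by (simp add: f dvd_smult_iff)
  qed
  have cancel_pow: "f dvd X ^ k * u \<Longrightarrow> f dvd u" for k u
  proof (induction k)
    case (Suc k)
    then have "f dvd X * (X ^ k * u)" by (simp only: power_Suc mult.assoc)
    then show ?case using Suc.IH cancel by blast
  qed (simp only: power_0 mult_1_left)
  have "f dvd X ^ d - 1" using cancel_pow[OF dvd] .
  moreover have "X ^ d = monom 1 d" by (simp add: X_def monom_altdef)
  ultimately show ?thesis using d(2) by auto
qed

lemma degree_monic_binomial:
  "0 < r \<Longrightarrow> degree (monom (1::'a::field) r - [:l:]) = r"
  using degree_add_eq_left[of "- [:l:]" "monom 1 r"]
  by (simp add: degree_monom_eq del: minus_pCons)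

lemma minimal_binomial_multiple_ex1:
  fixes f :: "'a::{finite,field} poly"
  assumes "0 < degree f" "coeff f 0 \<noteq> 0"
  shows "\<exists>!g. is_minimal_binomial_multiple f g"
proof -
  let ?P = "\<lambda>g. is_monic_binomial g \<and> f dvd g"
  obtain n where n: "0 < n" "f dvd monom 1 n - 1"
    using polynomial_order_exists[OF assms] by blast
  have "is_monic_binomial (monom 1 n - 1 :: 'a poly)"
    unfolding is_monic_binomial_def one_pCons using n(1) zero_neq_one by metis
  with n(2) have "?P (monom 1 n - 1)" by blast
  then have ex: "is_minimal_binomial_multiple f (arg_min degree ?P)"
    unfolding is_minimal_binomial_multiple_def
    by (metis (mono_tags, lifting) arg_min_nat_le arg_min_natI is_arg_min_linorder)
  have uniq: "g = h" if g: "is_minimal_binomial_multiple f g"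
    and h: "is_minimal_binomial_multiple f h" for g h
  proof -
    have P: "?P g" "?P h" and deg: "degree g = degree h"
      using g h unfolding is_minimal_binomial_multiple_def is_arg_min_linorder
      by (blast, blast, metis (no_types, lifting) order_antisym)
    obtain r l where r: "0 < r" "g = monom 1 r - [:l:]"
      using P(1) unfolding is_monic_binomial_def by blast
    obtain s m where s: "0 < s" "h = monom 1 s - [:m:]"
      using P(2) unfolding is_monic_binomial_def by blast
    have "s = r" using r s deg degree_monic_binomial by metis
    then have "g - h = [:m - l:]" using r s by simp
    moreover have "f dvd g - h" using P by (simp add: dvd_diff)
    ultimately have "[:m - l:] = 0"
      using assms(1) dvd_imp_degree_le[of f "[:m - l:]"] by fastforce
    then show "g = h" using \<open>g - h = [:m - l:]\<close> by simp
  qed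
  show ?thesis using ex uniq by blast
qed

end

theory Submission
  imports Defs
begin

text \<open>
  Modulo an irreducible \<open>f = X\<^sup>2 + b X + c\<close> the element \<open>X\<^sup>q\<close> is a root of \<open>f\<close> other than \<open>X\<close>,
  hence equal to \<open>- X - b\<close>, and so \<open>X\<^bsup>q+1\<^esup> \<equiv> c\<close>. Comparing coefficients in \<open>f H = X\<^bsup>q+2\<^esup> - c X\<close>
  gives the recurrence \<open>h\<^bsub>i+1\<^esub> = - b h\<^sub>i - c h\<^bsub>i-1\<^esub>\<close>, which is precisely the recurrence for the
  remainders of the powers of \<open>X\<close>: \<open>X\<^sup>i \<equiv> h\<^sub>i X - c h\<^bsub>i-1\<^esub>\<close>. Thus \<open>X\<^sup>i\<close> is congruent to a
  constant exactly when \<open>h\<^sub>i = 0\<close>.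
\<close>

text \<open>Multiplication by a nonzero \<open>x\<close> permutes the nonzero elements, so
  cancelling their product leaves \<open>x ^ (q - 1) = 1\<close>.\<close>

lemma power_CARD_eq_self:
  fixes x :: "'a::{finite,field}"
  shows "x ^ CARD('a) = x"
proof (cases "x = 0")
  case False
  let ?U = "UNIV - {0::'a}"
  have "bij_betw ((*) x) ?U ?U"
    using False by (intro bij_betwI[of _ _ _ "\<lambda>y. y / x"]) auto
  then have "(\<Prod>y\<in>?U. x * y) = \<Prod>?U"
    by (rule prod.reindex_bij_betw)
  then have "x ^ card ?U * \<Prod>?U = \<Prod>?U"
    by (simp add: prod.distrib)
  then have "x ^ card ?U = 1" by simp
  moreover have "CARD('a) = Suc (card ?U)"
    by (rule card_Suc_Diff1[symmetric]) simp_all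
  ultimately show ?thesis by (simp only: power_Suc mult_1_right)
qed simp

text \<open>
  Both sides of \<open>(X + 1)\<^sup>q = X\<^sup>q + 1\<close> are monic of degree \<open>q\<close> and agree on all \<open>q\<close> field elements,
  so no decomposition of \<open>q\<close> as a prime power is needed.
\<close>

lemma CARD_choose_eq_0:
  assumes "0 < k" "k < CARD('a::{finite,field})"
  shows "of_nat (CARD('a) choose k) = (0::'a)"
proof -
  let ?q = "CARD('a)"
  have q: "0 < ?q" by simp
  have "[:1, 1:] ^ ?q = (monom 1 ?q + 1 :: 'a poly)"
  proof (rule poly_eqI_degree_lead_coeff[where n = ?q and A = UNIV])
    show "coeff ([:1, 1:] ^ ?q) ?q = coeff (monom 1 ?q + 1 :: 'a poly) ?q"
      using q by (simp add: coeff_linear_poly_power)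
    show "degree ([:1, 1:] ^ ?q :: 'a poly) \<le> ?q"
      by (simp add: degree_power_eq)
    show "degree (monom 1 ?q + 1 :: 'a poly) \<le> ?q"
      by (intro degree_add_le) (simp_all add: degree_monom_eq)
  qed (simp_all add: poly_monom power_CARD_eq_self)
  then have "coeff ([:1, 1:] ^ ?q) k = coeff (monom 1 ?q + 1 :: 'a poly) k"
    by simp
  then show ?thesis
    using assms by (simp add: coeff_linear_poly_power)
qed

text \<open>Only the two extreme terms of the binomial expansion survive. Raising to the power
  \<open>q\<close> is thus additive, which lets it pass through \<open>f\<close>.\<close>

lemma poly_add_power_CARD:
  fixes u v :: "'a::{finite,field} poly"
  shows "(u + v) ^ CARD('a) = u ^ CARD('a) + v ^ CARD('a)"
proof -
  let ?q = "CARD('a)"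
  let ?t = "\<lambda>k. of_nat (?q choose k) * u ^ k * v ^ (?q - k)"
  have q: "0 < ?q" by simp
  have "(u + v) ^ ?q = (\<Sum>k\<le>?q. ?t k)" by (rule binomial_ring)
  also have "\<dots> = (\<Sum>k\<in>{0, ?q}. ?t k)"
  proof (intro sum.mono_neutral_right ballI)
    fix k assume "k \<in> {..?q} - {0, ?q}"
    then have "of_nat (?q choose k) = (0::'a)"
      by (intro CARD_choose_eq_0) auto
    then have "of_nat (?q choose k) = (0::'a poly)"
      by (simp add: of_nat_poly)
    then show "?t k = 0" by simp
  qed auto
  also have "\<dots> = u ^ ?q + v ^ ?q"
    using q by simp
  finally show ?thesis .
qed

text \<open>Both sides are monic of degree \<open>q\<close> and vanish at every field
  element.\<close>

lemma prod_linear_eq_monom_CARD: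
  "(\<Prod>a\<in>UNIV. [:- a, 1:]) = monom 1 CARD('a) - monom (1::'a::{finite,field}) 1"
proof (rule poly_eqI_degree_lead_coeff[where n = "CARD('a)" and A = UNIV])
  let ?P = "\<Prod>a\<in>(UNIV::'a set). [:- a, 1:]"
  have deg: "degree ?P = CARD('a)" by (subst degree_prod_sum_eq) auto
  have "lead_coeff ?P = 1" by (simp add: lead_coeff_prod)
  \<comment> \<open>\<open>1 < q\<close> keeps the term \<open>X\<close> away from the leading
    coefficient.\<close>
  moreover have "card {0::'a, 1} \<le> CARD('a)"
    by (rule card_mono) auto
  then have "1 < CARD('a)" by simp
  ultimately show "coeff ?P CARD('a) = coeff (monom 1 CARD('a) - monom 1 1) CARD('a)"
    using deg by simp
  show "degree ?P \<le> CARD('a)" using deg by simp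
  show "degree (monom 1 CARD('a) - monom (1::'a) 1) \<le> CARD('a)"
    using \<open>1 < CARD('a)\<close> by (intro degree_diff_le) (simp_all add: degree_monom_eq)
  show "poly ?P z = poly (monom 1 CARD('a) - monom 1 1) z" for z
    by (auto simp: poly_prod poly_monom power_CARD_eq_self prod_zero_iff)
qed simp

text \<open>A prime divisor of a product of linear factors divides one of them, which the degree
  excludes. This ensures that \<open>X ^ q\<close> and \<open>X\<close> are distinct roots modulo
  \<open>f\<close>.\<close>

lemma prime_elem_not_dvd_monom_CARD:
  fixes f :: "'a::{finite,field} poly"
  assumes "prime_elem f" "1 < degree f"
  shows "\<not> f dvd monom 1 CARD('a) - monom 1 1"
proof
  assume "f dvd monom 1 CARD('a) - monom 1 1"
  then have "f dvd (\<Prod>a\<in>UNIV. [:- a, 1:])"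
    by (simp only: prod_linear_eq_monom_CARD)
  then obtain a where "f dvd [:- a, 1:]"
    using assms(1) unfolding prod_unfold_prod_mset
    by (elim prime_elem_dvd_prod_msetE) auto
  then have "degree f \<le> degree [:- a, 1:]"
    by (rule dvd_imp_degree_le) simp
  then show False using assms(2) by simp
qed

lemma quadratic_dvd_monom_Suc_CARD:
  fixes b c :: "'a::{finite,field}"
  assumes "prime_elem [:c, b, 1:]"
  shows "[:c, b, 1:] dvd monom 1 (CARD('a) + 1) - [:c:]"
proof -
  let ?f = "[:c, b, 1:]" and ?q = "CARD('a)"
  define Y :: "'a poly" where "Y = monom 1 ?q"
  have Y: "Y = [:0, 1:] ^ ?q" by (simp add: Y_def monom_altdef)
  have const: "[:a:] ^ ?q = [:a:]" for a :: 'a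
    by (simp add: poly_const_pow power_CARD_eq_self)
  have f: "?f = [:0, 1:] ^ 2 + [:b:] * [:0, 1:] + [:c:]"
    by (simp add: power2_eq_square)
  \<comment> \<open>The \<open>q\<close>-th power fixes the coefficients \<open>b\<close> and
    \<open>c\<close>, so \<open>f ^ q\<close> is \<open>f\<close> evaluated at
    \<open>Y = X ^ q\<close>.\<close>
  have "?f ^ ?q = Y ^ 2 + [:b:] * Y + [:c:]"
    unfolding f poly_add_power_CARD power_mult_distrib const Y
    by (simp only: power_mult[symmetric] mult.commute)
  \<comment> \<open>The difference of the values of \<open>f\<close> at \<open>Y\<close> and at
    \<open>X\<close> factors as \<open>(Y - X) * (Y + X + b)\<close>.\<close>
  also have "\<dots> = ?f + (Y - [:0, 1:]) * (Y + [:b, 1:])"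
    by (simp add: algebra_simps power2_eq_square)
  finally have "?f ^ ?q = ?f + (Y - [:0, 1:]) * (Y + [:b, 1:])" .
  moreover have "?f dvd ?f ^ ?q" by (rule dvd_power) simp
  ultimately have "?f dvd (Y - [:0, 1:]) * (Y + [:b, 1:])"
    by (metis dvd_add_right_iff dvd_refl)
  moreover have "\<not> ?f dvd Y - [:0, 1:]"
    using prime_elem_not_dvd_monom_CARD[OF assms] by (simp add: Y_def monom_altdef)
  ultimately have "?f dvd Y + [:b, 1:]"
    using assms prime_elem_dvd_mult_iff by blast
  \<comment> \<open>Multiplying by \<open>X\<close> turns the root \<open>- X - b\<close> into
    \<open>- X ^ 2 - b * X\<close>, which is \<open>c\<close> modulo \<open>f\<close>.\<close>
  then have "?f dvd [:0, 1:] * (Y + [:b, 1:]) - ?f"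
    by (intro dvd_diff dvd_mult dvd_refl)
  also have "[:0, 1:] * (Y + [:b, 1:]) - ?f = monom 1 (?q + 1) - [:c:]"
    by (simp add: Y monom_altdef algebra_simps)
  finally show ?thesis .
qed

text \<open>With \<open>n = r * k + s\<close> and \<open>s < r\<close>, the power
  \<open>X ^ n\<close> is congruent to \<open>l ^ k * X ^ s\<close>. If this is congruent to 1,
  minimality of \<open>r\<close> forces \<open>s = 0\<close>, and then
  \<open>l ^ k = 1\<close>.\<close>

lemma polynomial_order_eq_mult_order:
  fixes f :: "'a::{finite,field} poly"
  assumes deg: "0 < degree f"
    and r: "0 < r" and l: "l \<noteq> 0"
    and dvd: "f dvd monom 1 r - [:l:]"
    and least: "\<And>s m. 0 < s \<Longrightarrow> m \<noteq> 0 \<Longrightarrow> f dvd monom 1 s - [:m:] \<Longrightarrow> r \<le> s"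
  shows "polynomial_order f = r * mult_order l"
proof -
  have pow: "f dvd monom 1 (r * k) - [:l ^ k:]" for k
  proof -
    have "monom 1 r - [:l:] dvd monom 1 r ^ k - [:l:] ^ k"
      by (cases k) (simp_all only: diff_power_eq_sum dvd_triv_left power_0 diff_self dvd_0_right)
    with dvd have "f dvd monom 1 r ^ k - [:l:] ^ k" by (rule dvd_trans)
    then show ?thesis by (simp add: monom_power poly_const_pow mult.commute)
  qed
  have mo: "0 < mult_order l \<and> l ^ mult_order l = 1"
    unfolding mult_order_def using mult_order_exists[OF l] by (rule LeastI_ex)
  show ?thesis
    unfolding polynomial_order_def
  proof (rule Least_equality)
    show "0 < r * mult_order l \<and> f dvd monom 1 (r * mult_order l) - 1"
      using r mo pow[of "mult_order l"] by (simp add: one_pCons)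
  next
    fix n assume n: "0 < n \<and> f dvd monom 1 n - 1"
    define k s where "k = n div r" and "s = n mod r"
    have nks: "n = r * k + s" by (simp add: k_def s_def)
    have "f dvd (monom 1 n - 1) - monom 1 s * (monom 1 (r * k) - [:l ^ k:])"
      using n by (intro dvd_diff[OF conjunct2 dvd_mult[OF pow]])
    also have "\<dots> = smult (l ^ k) (monom 1 s) - 1"
      by (simp add: nks algebra_simps mult_monom)
    finally have s: "f dvd smult (l ^ k) (monom 1 s) - 1" .
    have "s = 0"
    proof (rule ccontr)
      assume "s \<noteq> 0"
      \<comment> \<open>Scaling makes this a monic binomial multiple of degree \<open>s\<close>,
        below the minimum \<open>r\<close>.\<close>
      have "f dvd smult (inverse (l ^ k)) (smult (l ^ k) (monom 1 s) - 1)"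
        using s by (rule dvd_smult)
      then have "f dvd monom 1 s - [:inverse (l ^ k):]"
        using l by (simp add: smult_diff_right one_pCons)
      then have "r \<le> s" using least[of s "inverse (l ^ k)"] l \<open>s \<noteq> 0\<close> by simp
      then show False using mod_less_divisor[OF r, of n] by (simp add: s_def)
    qed
    then have "f dvd [:l ^ k - 1:]" using s by (simp add: one_pCons)
    then have "l ^ k = 1"
      using deg dvd_imp_degree_le[of f "[:l ^ k - 1:]"] by fastforce
    moreover have "0 < k" using n nks \<open>s = 0\<close> by (cases k) auto
    ultimately have "mult_order l \<le> k"
      unfolding mult_order_def by (intro Least_le) simp
    then show "r * mult_order l \<le> n" using nks \<open>s = 0\<close> by simp
  qed
qed

lemma minimal_binomial_multiple_eqI:
  fixes f :: "'a::{finite,field} poly"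
  assumes "0 < degree f" "coeff f 0 \<noteq> 0"
    and "0 < r" "l \<noteq> 0" "f dvd monom 1 r - [:l:]"
    and least: "\<And>s m. 0 < s \<Longrightarrow> m \<noteq> 0 \<Longrightarrow> f dvd monom 1 s - [:m:] \<Longrightarrow> r \<le> s"
  shows "minimal_binomial_multiple f = monom 1 r - [:l:]"
proof -
  have "is_minimal_binomial_multiple f (monom 1 r - [:l:])"
    unfolding is_minimal_binomial_multiple_def is_arg_min_linorder is_monic_binomial_def
  proof (intro conjI allI impI exI)
    fix g assume "(\<exists>r l. 0 < r \<and> l \<noteq> 0 \<and> g = monom 1 r - [:l:]) \<and> f dvd g"
    then obtain s m where "0 < s" "m \<noteq> 0" "g = monom 1 s - [:m:]" "f dvd monom 1 s - [:m:]"
      by blast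
    then show "degree (monom 1 r - [:l:]) \<le> degree g"
      using least assms(3) by (simp only: degree_monic_binomial)
  qed (use assms(3-5) in simp_all)
  then show ?thesis
    unfolding minimal_binomial_multiple_def
    using minimal_binomial_multiple_ex1[OF assms(1,2)] by (rule the1_equality[rotated])
qed

theorem theorem6p1:
  fixes b c lam :: "'a::{finite,field}"
    and f H :: "'a poly"
    and h :: "nat \<Rightarrow> 'a"
    and q r :: nat
  assumes "q = CARD('a)"
    and "f = [:c, b, 1:]"
    and "irreducible f"
    and "H = (monom 1 (q + 2) - monom c 1) div f"
    and "\<And>i. h i = coeff H (q + 1 - i)"
    and "r = Min {i. 2 \<le> i \<and> i \<le> q + 1 \<and> h i = 0}"
    and "lam = - c * h (r - 1)"
  shows "f dvd monom 1 (q + 1) - [:c:]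
    \<and> f * H = monom 1 (q + 2) - monom c 1
    \<and> H = (\<Sum>i = 1..q + 1. monom (h i) (q + 1 - i))
    \<and> h (q + 1) = 0
    \<and> binomial_order f = r
    \<and> lam \<noteq> 0
    \<and> minimal_binomial_multiple f = monom 1 r - [:lam:]
    \<and> polynomial_order f = r * mult_order lam"
proof -
  note f = assms(2) and h = assms(5)
  let ?X = "[:0, 1:] :: 'a poly"
  have q: "0 < q" by (simp add: assms(1))
  have prime: "prime_elem f"
    using assms(3) by (rule field_poly_irreducible_imp_prime)
  have deg: "degree f = 2" by (simp add: f)
  have small: "p = 0" if "f dvd p" "degree p < 2" for p
    using that deg dvd_imp_degree_le[of f p] by fastforce
  have notX: "\<not> f dvd ?X" using small[of ?X] by auto
  have c: "c \<noteq> 0"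
  proof
    assume "c = 0"
    then have "f = ?X * [:b, 1:]" by (simp add: f)
    then have "f dvd ?X \<or> f dvd [:b, 1:]"
      using prime prime_elem_dvd_mult_iff dvd_refl by metis
    then show False using notX small[of "[:b, 1:]"] by auto
  qed
  have dvd: "f dvd monom 1 (q + 1) - [:c:]"
    using quadratic_dvd_monom_Suc_CARD prime unfolding f assms(1) by blast
  \<comment> \<open>The numerator of \<open>H\<close> is \<open>X\<close> times the binomial that
    \<open>f\<close> divides, so the division is exact.\<close>
  have "?X * (monom 1 (q + 1) - [:c:]) = monom 1 (q + 2) - monom c 1"
    by (simp add: monom_altdef algebra_simps)
  then have fH: "f * H = monom 1 (q + 2) - monom c 1"
    using dvd dvd_mult unfolding assms(4) by (metis dvd_mult_div_cancel)
  have coeff0: "coeff (f * H) 0 = c * coeff H 0"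
    by (simp add: f)
  have coeff_rec: "coeff (f * H) (n + 2) = c * coeff H (n + 2) + b * coeff H (n + 1) + coeff H n" for n
    by (simp add: f)
  have hq: "h (q + 1) = 0"
    using coeff0 c unfolding fH by (simp add: h)
  have "degree (f * H) = q + 2"
    unfolding fH using degree_add_eq_left[of "- monom c 1" "monom 1 (q + 2)"] c
    by (simp add: degree_monom_eq)
  then have degH: "degree H = q"
    using deg degree_mult_eq[of f H] by (cases "f = 0 \<or> H = 0") auto
  \<comment> \<open>\<open>h 0\<close> is the coefficient of \<open>X ^ (q + 1)\<close>, just above
    the degree of \<open>H\<close>. It lets the recurrence start at \<open>i = 1\<close>.\<close>
  have h0: "h 0 = 0" using degH by (simp add: h coeff_eq_0)
  have h1: "h 1 = 1"
    using coeff_rec[of q] degH unfolding fH by (simp add: h coeff_eq_0)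
  have rec: "h (Suc i) = - b * h i - c * h (i - 1)" if "1 \<le> i" "i \<le> q" for i
  proof -
    have "q - i + 2 = q + 1 - (i - 1)" "q - i + 1 = q + 1 - i" "q - i = q + 1 - Suc i"
      using that by auto
    then have "coeff (f * H) (q - i + 2) = c * h (i - 1) + b * h i + h (Suc i)"
      using coeff_rec[of "q - i"] by (simp only: h)
    \<comment> \<open>The exponent lies between 2 and \<open>q + 1\<close>, strictly between those
      of the two terms on the right.\<close>
    moreover have "coeff (f * H) (q - i + 2) = 0"
      unfolding fH using that by simp
    ultimately show ?thesis by (simp add: algebra_simps eq_neg_iff_add_eq_0)
  qed
  have H_sum: "H = (\<Sum>i = 1..q + 1. monom (h i) (q + 1 - i))"
  proof -
    have "H = (\<Sum>j\<le>q. monom (coeff H j) j)"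
      using poly_as_sum_of_monoms[of H] degH by (simp only:)
    also have "\<dots> = (\<Sum>i = 1..q + 1. monom (h i) (q + 1 - i))"
      by (rule sum.reindex_bij_witness[of _ "\<lambda>i. q + 1 - i" "\<lambda>j. q + 1 - j"]) (auto simp: h)
    finally show ?thesis .
  qed
  have power_mod: "f dvd monom 1 i - [:- c * h (i - 1), h i:]" if "1 \<le> i" "i \<le> q + 1" for i
    using that
  proof (induction i rule: nat_induct_at_least)
    case base
    then show ?case using h0 h1 by (simp add: monom_altdef)
  next
    case (Suc i)
    \<comment> \<open>Adding \<open>h i * f\<close> cancels the \<open>X ^ 2\<close> produced by the
      factor \<open>X\<close>; the recurrence identifies the new coefficient of
      \<open>X\<close>.\<close>
    have "monom 1 (Suc i) - [:- c * h (Suc i - 1), h (Suc i):] =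
        ?X * (monom 1 i - [:- c * h (i - 1), h i:]) + [:h i:] * f"
      using Suc.hyps Suc.prems by (simp add: rec f monom_altdef)
    then show ?case using Suc by (metis Suc_leD dvd_add dvd_mult dvd_refl)
  qed
  have binomial: "h i = 0 \<and> l = - c * h (i - 1)"
    if "1 \<le> i" "i \<le> q + 1" "f dvd monom 1 i - [:l:]" for i l
  proof -
    have "f dvd (monom 1 i - [:l:]) - (monom 1 i - [:- c * h (i - 1), h i:])"
      by (rule dvd_diff[OF that(3) power_mod[OF that(1,2)]])
    then have "f dvd [:- c * h (i - 1) - l, h i:]" by (simp add: algebra_simps)
    then have "[:- c * h (i - 1) - l, h i:] = 0"
      by (rule small) simp
    then show ?thesis by simp
  qed
  let ?S = "{i. 2 \<le> i \<and> i \<le> q + 1 \<and> h i = 0}"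
  have fin: "finite ?S" by (rule finite_subset[of _ "{..q + 1}"]) auto
  have "q + 1 \<in> ?S" using hq q by simp
  then have "r \<in> ?S" unfolding assms(6) using fin by (intro Min_in) auto
  then have r: "2 \<le> r" "r \<le> q + 1" "h r = 0" by auto
  have dvd_r: "f dvd monom 1 r - [:lam:]"
    using power_mod[of r] r by (simp add: assms(7))
  have lam: "lam \<noteq> 0"
  proof
    assume "lam = 0"
    \<comment> \<open>Otherwise the prime \<open>f\<close> would divide a power of \<open>X\<close>,
      hence \<open>X\<close> itself.\<close>
    then have "f dvd ?X ^ r" using dvd_r by (simp add: monom_altdef)
    then show False using notX prime_elem_dvd_power[OF prime] by blast
  qed
  have least: "r \<le> s" if "0 < s" "m \<noteq> 0" "f dvd monom 1 s - [:m:]" for s m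
  proof (cases "s \<le> q + 1")
    case True
    then have "h s = 0" using binomial that by simp
    \<comment> \<open>Since \<open>h 1 = 1\<close>, exponent 1 gives no binomial multiple, so
      starting the minimum at 2 loses nothing. Exponents above \<open>q + 1\<close> already exceed
      \<open>r\<close>.\<close>
    moreover have "s \<noteq> 1" using \<open>h s = 0\<close> h1 by auto
    ultimately have "s \<in> ?S" using True that by simp
    then show ?thesis unfolding assms(6) using fin by (rule Min_le[rotated])
  qed (use r in simp)
  have min: "minimal_binomial_multiple f = monom 1 r - [:lam:]"
    using deg c r lam dvd_r least by (intro minimal_binomial_multiple_eqI) (auto simp: f)
  moreover have "binomial_order f = r"
    unfolding binomial_order_def min using r by (intro degree_monic_binomial) simp
  moreover have "polynomial_order f = r * mult_order lam"
    using deg r lam dvd_r least by (intro polynomial_order_eq_mult_order) auto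
  ultimately show ?thesis
    using dvd fH H_sum hq lam by blast
qed

end
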